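(* Let $(\mathrm{X}, \varphi)$ be an invertible measure-preserving system, let $F \subseteq \mathrm{L}^2(\mathrm{X})$ be a finite-dimensional linear subspace and let $\varepsilon > 0$. For $n\in\mathbb{N}$ let $F_n := \operatorname{span}\bigcup_{k=0}^n T_\varphi^k F$. Then there exist $K_0 \in \mathbb{N}$ and $\delta > 0$ with the following property: whenever $n \in \mathbb{N}$, $K \geq K_0$ and $\hat T_n \colon F_n \to F_n$ is a linear operator such that $$\lVert \hat T_n^k f - T_\varphi^k f \rVert \leq \delta \lVert f \rVert \quad\text{for all } f \in F_n \text{ and all } k \in \{0, \dots, K - 1\},$$ then $$\dim(F_n) \geq K \bigl(h_{\mathrm{apr}}(T_\varphi, F) - \varepsilon\bigr).$$
   Context: Here $\mathbb{N}$ (as the range of $n$) includes $0$, with $F_0=F$. A measure-preserving system $(\mathrm{X},\varphi)$ consists of a probability space $\mathrm{X}=(X,\Sigma,\mu)$ and a $\Sigma$-measurable map $\varphi\colon X\to X$ with $\mu(\varphi^{-1}(A))=\mu(A)$ for all $A\in\Sigma$. It is invertible if there is a measure-preserving map $\varphi^{-1}\colon X\to X$ with $\varphi^{-1}\circ\varphi=\varphi\circ\varphi^{-1}=\mathrm{id}_X$ $\mu$-almost surely. $\mathrm{L}^2(\mathrm{X})$ is the usual Hilbert space of (classes of) square-integrable functions $X\to\mathbb{K}$, $\mathbb{K}\in\{\mathbb{R},\mathbb{C}\}$, with its norm $\lVert\cdot\rVert$. The Koopman operator is $T_\varphi f=f\circ\varphi$ on $\mathrm{L}^2(\mathrm{X})$;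 it is unitary when the system is invertible. Approximation entropy. Let $H$ be a Hilbert space and $T\colon H\to H$ unitary. For a finite set $\omega\subseteq H$ and $\delta>0$ let $H_{\mathrm{apr}}(\omega,\delta)$ be the minimum of $\dim E$ over all finite-dimensional subspaces $E\subseteq H$ such that for every $x\in\omega$ there is $y\in E$ with $\lVert x-y\rVert<\delta$. Put $h_{\mathrm{apr}}(T,\omega,\delta):=\lim_{n\to\infty}\frac1n H_{\mathrm{apr}}\bigl(\bigcup_{k=0}^{n-1}T^k\omega,\delta\bigr)$ (the limit exists) and $h_{\mathrm{apr}}(T,\omega):=\sup_{\delta>0}h_{\mathrm{apr}}(T,\omega,\delta)$. For a closed linear subspace $F\subseteq H$ (not necessarily $T$-invariant), $h_{\mathrm{apr}}(T,F):=\sup\{h_{\mathrm{apr}}(T,\omega):\omega\subseteq F\text{ finite}\}$. *)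

theory Defs
  imports "HOL-Probability.Probability" "HOL-Algebra.Embedded_Algebras"
begin

text \<open>
  Throughout, the scalar field is a type of class
  \<open>{real_normed_field, euclidean_space}\<close>.  This covers both \<^typ>\<open>real\<close> and \<^typ>\<open>complex\<close>, and up to
  isometric isomorphism nothing else: a finite-dimensional commutative real division algebra is
  \<open>\<real>\<close> or \<open>\<complex>\<close>, and the multiplicative norm on it is the modulus.
\<close>

definition meas_ring :: "'a measure \<Rightarrow> ('a \<Rightarrow> 'k::{real_normed_field, euclidean_space}) ring" where
  "meas_ring M = \<lparr>carrier = borel_measurable M, mult = (\<lambda>f g x. f x * g x), one = (\<lambda>x. 1),
     zero = (\<lambda>x. 0), add = (\<lambda>f g x. f x + g x)\<rparr>"

definition null_ideal :: "'a measure \<Rightarrow> ('a \<Rightarrow> 'k::{real_normed_field, euclidean_space}) set" where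
  "null_ideal M = {f \<in> borel_measurable M. AE x in M. f x = 0}"

text \<open>
  The elements of \<open>L0 M\<close> are the cosets of the ideal of null functions, that is, the almost everywhere
  classes of measurable functions (lemma \<open>ae_class_eq\<close> below).  The linear algebra of \<open>L2 M\<close> is
  that of a subspace of \<open>L0 M\<close> over the subfield \<open>scalars M\<close> of constants, so that
  \<^const>\<open>subalgebra\<close> \<open>(scalars M) V (L0 M)\<close> says that \<open>V\<close> is a linear subspace (it need not be closed
  under products), and dimension is \<^const>\<open>ring.dim\<close>.
\<close>

definition L0 :: "'a measure \<Rightarrow> ('a \<Rightarrow> 'k::{real_normed_field, euclidean_space}) set ring" where
  "L0 M = meas_ring M Quot null_ideal M"

definition ae_class ::
  "'a measure \<Rightarrow> ('a \<Rightarrow> 'k) \<Rightarrow> ('a \<Rightarrow> 'k::{real_normed_field, euclidean_space}) set" where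
  "ae_class M f = null_ideal M +>\<^bsub>meas_ring M\<^esub> f"

definition rep :: "('a \<Rightarrow> 'k) set \<Rightarrow> 'a \<Rightarrow> 'k" where
  "rep u = (SOME f. f \<in> u)"

definition scalars :: "'a measure \<Rightarrow> ('a \<Rightarrow> 'k::{real_normed_field, euclidean_space}) set set" where
  "scalars M = range (\<lambda>c. ae_class M (\<lambda>x. c))"

definition L2 :: "'a measure \<Rightarrow> ('a \<Rightarrow> 'k::{real_normed_field, euclidean_space}) set set" where
  "L2 M = {ae_class M f | f. f \<in> borel_measurable M \<and> integrable M (\<lambda>x. (norm (f x))\<^sup>2)}"

definition L2_norm :: "'a measure \<Rightarrow> ('a \<Rightarrow> 'k::{real_normed_field, euclidean_space}) set \<Rightarrow> real" where
  "L2_norm M u = sqrt (\<integral>x. (norm (rep u x))\<^sup>2 \<partial>M)"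

definition lin_subspace ::
  "'a measure \<Rightarrow> ('a \<Rightarrow> 'k::{real_normed_field, euclidean_space}) set set \<Rightarrow> bool" where
  "lin_subspace M V \<longleftrightarrow> V \<subseteq> L2 M \<and> subalgebra (scalars M) V (L0 M)"

definition fin_dim_subspace ::
  "'a measure \<Rightarrow> ('a \<Rightarrow> 'k::{real_normed_field, euclidean_space}) set set \<Rightarrow> bool" where
  "fin_dim_subspace M V \<longleftrightarrow> lin_subspace M V \<and> ring.finite_dimension (L0 M) (scalars M) V"

definition lin_span :: "'a measure \<Rightarrow> ('a \<Rightarrow> 'k) set set
    \<Rightarrow> ('a \<Rightarrow> 'k::{real_normed_field, euclidean_space}) set set" where
  "lin_span M S = \<Inter> {V. lin_subspace M V \<and> S \<subseteq> V}"

definition lin_dim ::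
  "'a measure \<Rightarrow> ('a \<Rightarrow> 'k::{real_normed_field, euclidean_space}) set set \<Rightarrow> nat" where
  "lin_dim M V = ring.dim (L0 M) (scalars M) V"

definition linear_operator_on :: "'a measure \<Rightarrow> ('a \<Rightarrow> 'k) set set
    \<Rightarrow> (('a \<Rightarrow> 'k) set \<Rightarrow> ('a \<Rightarrow> 'k::{real_normed_field, euclidean_space}) set) \<Rightarrow> bool" where
  "linear_operator_on M V S \<longleftrightarrow> S \<in> V \<rightarrow> V \<and>
     (\<forall>u\<in>V. \<forall>v\<in>V. S (u \<oplus>\<^bsub>L0 M\<^esub> v) = S u \<oplus>\<^bsub>L0 M\<^esub> S v) \<and>
     (\<forall>c\<in>scalars M. \<forall>u\<in>V. S (c \<otimes>\<^bsub>L0 M\<^esub> u) = c \<otimes>\<^bsub>L0 M\<^esub> S u)"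

definition measure_preserving :: "'a measure \<Rightarrow> ('a \<Rightarrow> 'a) \<Rightarrow> bool" where
  "measure_preserving M \<phi> \<longleftrightarrow> \<phi> \<in> measurable M M \<and>
     (\<forall>A\<in>sets M. emeasure M (\<phi> -` A \<inter> space M) = emeasure M A)"

definition invertible_mps :: "'a measure \<Rightarrow> ('a \<Rightarrow> 'a) \<Rightarrow> bool" where
  "invertible_mps M \<phi> \<longleftrightarrow> prob_space M \<and> measure_preserving M \<phi> \<and>
     (\<exists>\<psi>. measure_preserving M \<psi> \<and> (AE x in M. \<psi> (\<phi> x) = x) \<and> (AE x in M. \<phi> (\<psi> x) = x))"

definition koopman :: "'a measure \<Rightarrow> ('a \<Rightarrow> 'a) \<Rightarrow> ('a \<Rightarrow> 'k) set
    \<Rightarrow> ('a \<Rightarrow> 'k::{real_normed_field, euclidean_space}) set" where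
  "koopman M \<phi> u = ae_class M (rep u \<circ> \<phi>)"

definition H_apr ::
  "'a measure \<Rightarrow> ('a \<Rightarrow> 'k::{real_normed_field, euclidean_space}) set set \<Rightarrow> real \<Rightarrow> nat" where
  "H_apr M \<omega> \<delta> = (LEAST d. \<exists>E. fin_dim_subspace M E \<and> lin_dim M E = d \<and>
     (\<forall>x\<in>\<omega>. \<exists>y\<in>E. L2_norm M (x \<ominus>\<^bsub>L0 M\<^esub> y) < \<delta>))"

definition h_apr_at :: "'a measure \<Rightarrow> (('a \<Rightarrow> 'k) set \<Rightarrow> ('a \<Rightarrow> 'k) set)
    \<Rightarrow> ('a \<Rightarrow> 'k::{real_normed_field, euclidean_space}) set set \<Rightarrow> real \<Rightarrow> real" where
  "h_apr_at M T \<omega> \<delta> = lim (\<lambda>n. real (H_apr M (\<Union>k<n. (T ^^ k) ` \<omega>) \<delta>) / real n)"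

definition h_apr_fin :: "'a measure \<Rightarrow> (('a \<Rightarrow> 'k) set \<Rightarrow> ('a \<Rightarrow> 'k) set)
    \<Rightarrow> ('a \<Rightarrow> 'k::{real_normed_field, euclidean_space}) set set \<Rightarrow> ereal" where
  "h_apr_fin M T \<omega> = (SUP \<delta>\<in>{0<..}. ereal (h_apr_at M T \<omega> \<delta>))"

definition h_apr :: "'a measure \<Rightarrow> (('a \<Rightarrow> 'k) set \<Rightarrow> ('a \<Rightarrow> 'k) set)
    \<Rightarrow> ('a \<Rightarrow> 'k::{real_normed_field, euclidean_space}) set set \<Rightarrow> ereal" where
  "h_apr M T F = (SUP \<omega>\<in>{\<omega>. finite \<omega> \<and> \<omega> \<subseteq> F}. h_apr_fin M T \<omega>)"

lemma meas_ring_cring: "cring (meas_ring M)"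
proof -
  have "\<exists>g\<in>borel_measurable M. (\<lambda>x. g x + f x) = (\<lambda>x. 0)" if "f \<in> borel_measurable M"
    for f :: "'a \<Rightarrow> 'k::{real_normed_field, euclidean_space}"
    using that by (intro bexI[of _ "\<lambda>x. - f x"]) auto
  then show ?thesis
    by (intro cringI abelian_groupI comm_monoidI)
      (auto simp: meas_ring_def algebra_simps)
qed

lemma null_ideal_ideal:
  "ideal (null_ideal M) (meas_ring M :: ('a \<Rightarrow> 'k::{real_normed_field, euclidean_space}) ring)"
proof -
  interpret R: cring "meas_ring M :: ('a \<Rightarrow> 'k::{real_normed_field, euclidean_space}) ring"
    by (rule meas_ring_cring)
  have inv: "\<ominus>\<^bsub>meas_ring M\<^esub> f = (\<lambda>x. - f x)" if "f \<in> borel_measurable M" for f :: "'a \<Rightarrow> 'k"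
    by (rule R.minus_equality) (use that in \<open>auto simp: meas_ring_def\<close>)
  show ?thesis
  proof (rule idealI[OF R.ring_axioms])
    show "subgroup (null_ideal M) (add_monoid (meas_ring M :: ('a \<Rightarrow> 'k) ring))"
    proof (rule R.add.subgroupI)
      show "null_ideal M \<subseteq> carrier (meas_ring M :: ('a \<Rightarrow> 'k) ring)"
        by (auto simp: null_ideal_def meas_ring_def)
      show "null_ideal M \<noteq> ({} :: ('a \<Rightarrow> 'k) set)"
      proof -
        have "(\<lambda>x. 0) \<in> (null_ideal M :: ('a \<Rightarrow> 'k) set)" by (simp add: null_ideal_def)
        then show ?thesis by blast
      qed
      show "\<ominus>\<^bsub>meas_ring M\<^esub> a \<in> null_ideal M" if "a \<in> null_ideal M" for a :: "'a \<Rightarrow> 'k"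
        using that by (subst inv) (auto simp: null_ideal_def)
      show "a \<oplus>\<^bsub>meas_ring M\<^esub> b \<in> null_ideal M" if "a \<in> null_ideal M" "b \<in> null_ideal M"
        for a b :: "'a \<Rightarrow> 'k"
        using that by (auto simp: null_ideal_def meas_ring_def)
    qed
  qed (auto simp: null_ideal_def meas_ring_def)
qed

lemma L0_cring: "cring (L0 M)"
  unfolding L0_def by (rule ideal.quotient_is_cring[OF null_ideal_ideal meas_ring_cring])

lemma ae_class_eq:
  assumes "f \<in> borel_measurable M"
  shows "ae_class M f = {g \<in> borel_measurable M. AE x in M. g x = f x}"
proof (intro Set.set_eqI iffI)
  fix g assume "g \<in> ae_class M f"
  then show "g \<in> {g \<in> borel_measurable M. AE x in M. g x = f x}"
    using assms by (auto simp: ae_class_def a_r_coset_defs null_ideal_def meas_ring_def)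
next
  fix g assume g: "g \<in> {g \<in> borel_measurable M. AE x in M. g x = f x}"
  then have "(\<lambda>x. g x - f x) \<in> null_ideal M" "g = (\<lambda>x. (g x - f x) + f x)"
    using assms by (auto simp: null_ideal_def)
  then show "g \<in> ae_class M f"
    by (force simp: ae_class_def a_r_coset_defs meas_ring_def)
qed

lemma rep_ae_class:
  assumes "f \<in> borel_measurable M"
  shows "rep (ae_class M f) \<in> borel_measurable M" "AE x in M. rep (ae_class M f) x = f x"
proof -
  have "f \<in> ae_class M f" using assms by (simp add: ae_class_eq)
  then have "rep (ae_class M f) \<in> ae_class M f" unfolding rep_def by (rule someI[where P = "\<lambda>f. f \<in> ae_class M f'" for f'])
  then show "rep (ae_class M f) \<in> borel_measurable M" "AE x in M. rep (ae_class M f) x = f x"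
    using assms by (auto simp: ae_class_eq)
qed

lemma L2_norm_ae_class:
  assumes "f \<in> borel_measurable M"
  shows "L2_norm M (ae_class M f) = sqrt (\<integral>x. (norm (f x))\<^sup>2 \<partial>M)"
  unfolding L2_norm_def using rep_ae_class[OF assms] assms
  by (intro arg_cong[where f = sqrt] integral_cong_AE) auto

lemma measure_preserving_distr:
  assumes "measure_preserving M \<phi>" shows "distr M M \<phi> = M"
  using assms by (intro measure_eqI) (auto simp: measure_preserving_def emeasure_distr)

lemma koopman_ae_class:
  assumes "measure_preserving M \<phi>" "f \<in> borel_measurable M"
  shows "koopman M \<phi> (ae_class M f) = ae_class M (f \<circ> \<phi>)"
proof -
  have \<phi>: "\<phi> \<in> measurable M M" using assms by (simp add: measure_preserving_def)
  have m: "f \<circ> \<phi> \<in> borel_measurable M" "rep (ae_class M f) \<circ> \<phi> \<in> borel_measurable M"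
    using measurable_comp[OF \<phi> assms(2)] measurable_comp[OF \<phi> rep_ae_class(1)[OF assms(2)]] by auto
  have "AE x in distr M M \<phi>. rep (ae_class M f) x = f x"
    unfolding measure_preserving_distr[OF assms(1)] by (rule rep_ae_class(2)[OF assms(2)])
  then have "AE x in M. (rep (ae_class M f) \<circ> \<phi>) x = (f \<circ> \<phi>) x"
    by (auto dest: AE_distrD[OF \<phi>])
  then show ?thesis
    unfolding koopman_def ae_class_eq[OF m(1)] ae_class_eq[OF m(2)] by auto
qed

lemma ae_class_add:
  assumes "f \<in> borel_measurable M" "g \<in> borel_measurable M"
  shows "ae_class M f \<oplus>\<^bsub>L0 M\<^esub> ae_class M g = ae_class M (\<lambda>x. f x + g x)"
proof -
  interpret I: ideal "null_ideal M" "meas_ring M :: ('a \<Rightarrow> 'b) ring"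
    by (rule null_ideal_ideal)
  show ?thesis
    using I.a_rcos_sum[of f g] assms
    by (simp add: ae_class_def L0_def FactRing_def meas_ring_def)
qed

lemma ae_class_mult:
  assumes "f \<in> borel_measurable M" "g \<in> borel_measurable M"
  shows "ae_class M f \<otimes>\<^bsub>L0 M\<^esub> ae_class M g = ae_class M (\<lambda>x. f x * g x)"
proof -
  interpret I: ideal "null_ideal M" "meas_ring M :: ('a \<Rightarrow> 'b) ring"
    by (rule null_ideal_ideal)
  show ?thesis
    using I.rcoset_mult_add[of f g] assms
    by (simp add: ae_class_def L0_def FactRing_def meas_ring_def)
qed

lemma ae_class_in_L0: "f \<in> borel_measurable M \<Longrightarrow> ae_class M f \<in> carrier (L0 M)"
  by (auto simp: ae_class_def L0_def FactRing_def A_RCOSETS_defs a_r_coset_defs meas_ring_def)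

lemma L0_zero: "\<zero>\<^bsub>L0 M\<^esub> = ae_class M (\<lambda>x. 0)"
  by (subst ae_class_eq) (auto simp: L0_def FactRing_def null_ideal_def)

lemma L0_one: "\<one>\<^bsub>L0 M\<^esub> = ae_class M (\<lambda>x. 1)"
  by (simp add: L0_def FactRing_def ae_class_def meas_ring_def)

lemma L0_uminus:
  assumes "f \<in> borel_measurable M"
  shows "\<ominus>\<^bsub>L0 M\<^esub> ae_class M f = ae_class M (\<lambda>x. - f x)"
proof -
  interpret cring "L0 M :: ('a \<Rightarrow> 'b) set ring" by (rule L0_cring)
  show ?thesis
    using assms by (intro minus_equality) (auto simp: ae_class_add L0_zero ae_class_in_L0)
qed

lemma scalars_subfield:
  assumes "prob_space M"
  shows "subfield (scalars M :: ('a \<Rightarrow> 'k::{real_normed_field, euclidean_space}) set set) (L0 M)"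
proof -
  interpret prob_space M by fact
  interpret R: cring "L0 M :: ('a \<Rightarrow> 'k) set ring" by (rule L0_cring)
  let ?c = "\<lambda>c::'k. ae_class M (\<lambda>x. c)"
  have inj: "?c a = ?c b \<longleftrightarrow> a = b" for a b
  proof
    assume "?c a = ?c b"
    then have "(\<lambda>x. a) \<in> ?c b" by (simp add: ae_class_eq flip: \<open>?c a = ?c b\<close>)
    then show "a = b" by (simp add: ae_class_eq)
  qed simp
  show ?thesis
  proof (rule R.subfieldI)
    show "subcring (scalars M :: ('a \<Rightarrow> 'k) set set) (L0 M)"
      by (intro R.subcringI R.subringI)
        (auto simp: scalars_def ae_class_in_L0 L0_one L0_uminus ae_class_add ae_class_mult mult.commute)
    show "Units (L0 M \<lparr>carrier := scalars M\<rparr>) = scalars M - {\<zero>\<^bsub>L0 M\<^esub> :: ('a \<Rightarrow> 'k) set}"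
    proof (intro equalityI subsetI)
      fix u :: "('a \<Rightarrow> 'k) set"
      assume "u \<in> Units (L0 M \<lparr>carrier := scalars M\<rparr>)"
      then obtain a b where "u = ?c a" "?c b \<otimes>\<^bsub>L0 M\<^esub> ?c a = \<one>\<^bsub>L0 M\<^esub>"
        by (auto simp: Units_def scalars_def)
      moreover from this have "a \<noteq> 0" by (auto simp: ae_class_mult L0_one inj)
      ultimately show "u \<in> scalars M - {\<zero>\<^bsub>L0 M\<^esub>}"
        by (auto simp: scalars_def L0_zero inj)
    next
      fix u :: "('a \<Rightarrow> 'k) set"
      assume "u \<in> scalars M - {\<zero>\<^bsub>L0 M\<^esub>}"
      then obtain a where a: "u = ?c a" "a \<noteq> 0" by (auto simp: scalars_def L0_zero)
      then have "?c (inverse a) \<otimes>\<^bsub>L0 M\<^esub> u = \<one>\<^bsub>L0 M\<^esub>" "u \<otimes>\<^bsub>L0 M\<^esub> ?c (inverse a) = \<one>\<^bsub>L0 M\<^esub>"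
        by (simp_all add: ae_class_mult L0_one)
      moreover have "?c (inverse a) \<in> scalars M" "u \<in> scalars M" by (auto simp: scalars_def a)
      ultimately show "u \<in> Units (L0 M \<lparr>carrier := scalars M\<rparr>)"
        by (auto simp: Units_def)
    qed
  qed
qed

lemma L2_lin_subspace:
  assumes "prob_space M"
  shows "lin_subspace M (L2 M :: ('a \<Rightarrow> 'k::{real_normed_field, euclidean_space}) set set)"
proof -
  interpret R: cring "L0 M :: ('a \<Rightarrow> 'k) set ring" by (rule L0_cring)
  have add: "integrable M (\<lambda>x. (norm (f x + g x))\<^sup>2)"
    if "f \<in> borel_measurable M" "g \<in> borel_measurable M"
      "integrable M (\<lambda>x. (norm (f x))\<^sup>2)" "integrable M (\<lambda>x. (norm (g x))\<^sup>2)" for f g :: "'a \<Rightarrow> 'k"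
  proof (rule Bochner_Integration.integrable_bound)
    show "integrable M (\<lambda>x. 2 * (norm (f x))\<^sup>2 + 2 * (norm (g x))\<^sup>2)" using that by simp
    have "(norm (a + b))\<^sup>2 \<le> 2 * (norm a)\<^sup>2 + 2 * (norm b)\<^sup>2" for a b :: 'k
    proof -
      have "(norm (a + b))\<^sup>2 \<le> (norm a + norm b)\<^sup>2"
        by (intro power_mono norm_triangle_ineq) simp
      also have "\<dots> \<le> 2 * (norm a)\<^sup>2 + 2 * (norm b)\<^sup>2"
        using sum_squares_bound[of "norm a" "norm b"] by (simp add: power2_sum)
      finally show ?thesis .
    qed
    then show "AE x in M. norm ((norm (f x + g x))\<^sup>2)
        \<le> norm (2 * (norm (f x))\<^sup>2 + 2 * (norm (g x))\<^sup>2)" by simp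
  qed (use that in measurable)
  have "subgroup (L2 M :: ('a \<Rightarrow> 'k) set set) (add_monoid (L0 M))"
  proof (rule R.add.subgroupI)
    show "L2 M \<subseteq> carrier (L0 M :: ('a \<Rightarrow> 'k) set ring)" by (auto simp: L2_def ae_class_in_L0)
    show "L2 M \<noteq> ({} :: ('a \<Rightarrow> 'k) set set)"
    proof -
      have "ae_class M (\<lambda>x. 0) \<in> (L2 M :: ('a \<Rightarrow> 'k) set set)"
        unfolding L2_def by (intro CollectI exI[of _ "\<lambda>x. 0"]) simp
      then show ?thesis by blast
    qed
    show "\<ominus>\<^bsub>L0 M\<^esub> u \<in> L2 M" if "u \<in> L2 M" for u :: "('a \<Rightarrow> 'k) set"
    proof -
      from that obtain f where "u = ae_class M f" "f \<in> borel_measurable M"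
        "integrable M (\<lambda>x. (norm (f x))\<^sup>2)" by (auto simp: L2_def)
      then show ?thesis
        unfolding L2_def by (intro CollectI exI[of _ "\<lambda>x. - f x"]) (simp add: L0_uminus)
    qed
    show "u \<oplus>\<^bsub>L0 M\<^esub> v \<in> L2 M" if "u \<in> L2 M" "v \<in> L2 M" for u v :: "('a \<Rightarrow> 'k) set"
    proof -
      from that obtain f g where "u = ae_class M f" "f \<in> borel_measurable M"
        "integrable M (\<lambda>x. (norm (f x))\<^sup>2)" "v = ae_class M g" "g \<in> borel_measurable M"
        "integrable M (\<lambda>x. (norm (g x))\<^sup>2)" by (auto simp: L2_def)
      then show ?thesis
        unfolding L2_def by (intro CollectI exI[of _ "\<lambda>x. f x + g x"]) (simp add: ae_class_add add)
    qed
  qed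
  moreover have "c \<otimes>\<^bsub>L0 M\<^esub> u \<in> L2 M" if "c \<in> scalars M" "u \<in> L2 M"
    for c u :: "('a \<Rightarrow> 'k) set"
  proof -
    from that obtain a f where "c = ae_class M (\<lambda>x. a)" "u = ae_class M f"
      "f \<in> borel_measurable M" "integrable M (\<lambda>x. (norm (f x))\<^sup>2)"
      by (auto simp: L2_def scalars_def)
    then show ?thesis
      unfolding L2_def
      by (intro CollectI exI[of _ "\<lambda>x. a * f x"])
        (simp add: ae_class_mult norm_mult power_mult_distrib)
  qed
  ultimately show ?thesis
    by (auto simp: lin_subspace_def subalgebra_def subalgebra_axioms_def)
qed

lemma koopman_L2:
  assumes "measure_preserving M \<phi>" "u \<in> L2 M"
  shows "koopman M \<phi> u \<in> L2 M" "L2_norm M (koopman M \<phi> u) = L2_norm M u"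
proof -
  from assms(2) obtain f where f: "u = ae_class M f" "f \<in> borel_measurable M"
    "integrable M (\<lambda>x. (norm (f x))\<^sup>2)" by (auto simp: L2_def)
  have \<phi>: "\<phi> \<in> measurable M M" using assms by (simp add: measure_preserving_def)
  have m: "f \<circ> \<phi> \<in> borel_measurable M" using measurable_comp[OF \<phi> f(2)] .
  have sq: "(\<lambda>x. (norm (f x))\<^sup>2) \<in> borel_measurable M" using f(2) by measurable
  have "integrable (distr M M \<phi>) (\<lambda>x. (norm (f x))\<^sup>2)"
    unfolding measure_preserving_distr[OF assms(1)] by (rule f(3))
  then have i: "integrable M (\<lambda>x. (norm ((f \<circ> \<phi>) x))\<^sup>2)"
    by (simp add: integrable_distr_eq[OF \<phi> sq])
  show "koopman M \<phi> u \<in> L2 M"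
    using m i by (auto simp: f(1) koopman_ae_class[OF assms(1) f(2)] L2_def)
  have "(\<integral>x. (norm (f x))\<^sup>2 \<partial>distr M M \<phi>) = (\<integral>x. (norm (f (\<phi> x)))\<^sup>2 \<partial>M)"
    by (rule integral_distr[OF \<phi> sq])
  then show "L2_norm M (koopman M \<phi> u) = L2_norm M u"
    by (simp add: f(1) koopman_ae_class[OF assms(1) f(2)] L2_norm_ae_class[OF m]
        L2_norm_ae_class[OF f(2)] measure_preserving_distr[OF assms(1)])
qed

end

theory Submission
  imports Defs
begin

text \<open>
  For a finite set \<open>\<omega>\<close> the numbers \<open>H(n) = H_apr (\<Union>k<n. T^k \<omega>) \<eta>\<close> are subadditive, because \<open>T\<close> is an
  isometry: if \<open>E\<close> and \<open>E'\<close> approximate \<open>\<Union>k<m. T^k \<omega>\<close> and \<open>\<Union>k<n. T^k \<omega>\<close>, then \<open>E + T^m E'\<close>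
  approximates \<open>\<Union>k<m+n. T^k \<omega>\<close>.  By Fekete's lemma \<open>h_apr_at T \<omega> \<eta>\<close> is therefore a lower bound of
  every quotient \<open>H(K) / K\<close>.  Choose \<open>\<omega>\<close> and \<open>\<eta>\<close> such that \<open>h_apr_at T \<omega> \<eta> > h_apr T F - \<epsilon>\<close>, and
  \<open>\<delta>\<close> so small that \<open>\<delta> \<parallel>f\<parallel> < \<eta>\<close> on \<open>\<omega>\<close>.  An operator \<open>S\<close> as in the theorem maps \<open>F_n\<close> to itself, so
  \<open>F_n\<close> contains all \<open>S^k f\<close> and hence approximates \<open>\<Union>k<K. T^k \<omega>\<close>; thus \<open>dim F_n \<ge> H(K)\<close>, for
  every \<open>K\<close>.
\<close>

section \<open>Limits of subadditive sequences\<close>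

text \<open>Fix \<open>m\<close> with \<open>u m / m\<close> close to the infimum and divide
  \<open>n\<close> by \<open>m\<close> with remainder: the full blocks contribute at most about
  \<open>u m / m\<close> after division by \<open>n\<close>, and the remainder a bounded amount that
  then vanishes. The infimum starts at 1 because \<open>u 0 / 0\<close> is 0 in HOL and would pull
  it down.\<close>

lemma fekete:
  fixes u :: "nat \<Rightarrow> nat"
  assumes sub: "\<And>m n. u (m + n) \<le> u m + u n"
  shows "(\<lambda>n. real (u n) / real n) \<longlonglongrightarrow> (INF n\<in>{1..}. real (u n) / real n)"
proof -
  define L where "L = (INF n\<in>{1..}. real (u n) / real n)"
  have bdd: "bdd_below ((\<lambda>n. real (u n) / real n) ` {1..})"
    by (rule bdd_belowI[of _ 0]) auto
  have lower: "L \<le> real (u n) / real n" if "n \<ge> 1" for n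
    unfolding L_def by (rule cINF_lower[OF bdd]) (use that in auto)
  have mult: "u (q * m + r) \<le> q * u m + u r" for q m r
  proof (induction q)
    case (Suc q)
    then show ?case using sub[of m "q * m + r"] by (simp add: algebra_simps)
  qed simp
  have "(\<lambda>n. real (u n) / real n) \<longlonglongrightarrow> L"
  proof (rule LIMSEQ_I)
    fix e :: real assume e: "e > 0"
    have "\<exists>m\<in>{1..}. real (u m) / real m < L + e / 2"
      using cInf_lessD[of "(\<lambda>n. real (u n) / real n) ` {1..}" "L + e / 2"] e
      by (auto simp: L_def)
    then obtain m where m: "m \<ge> 1" "real (u m) / real m < L + e / 2" by auto
    \<comment> \<open>A bound for all remainders modulo \<open>m\<close>. It does not depend on
      \<open>n\<close>, so a large \<open>n\<close> pushes \<open>C / n\<close> below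
      \<open>e / 2\<close>.\<close>
    define C where "C = Max (u ` {..<m})"
    have C: "u r \<le> C" if "r < m" for r
      unfolding C_def using that by auto
    obtain N :: nat where N: "real N > 2 * real C / e" using reals_Archimedean2 by blast
    show "\<exists>no. \<forall>n\<ge>no. norm (real (u n) / real n - L) < e"
    proof (intro exI allI impI)
      fix n assume n: "n \<ge> Suc N"
      then have n0: "real n > 0" by simp
      have "u n \<le> (n div m) * u m + u (n mod m)" using mult[of "n div m" m "n mod m"] by simp
      also have "\<dots> \<le> (n div m) * u m + C" using C[of "n mod m"] m by simp
      finally have "real (u n) \<le> real (n div m) * real (u m) + real C"
        by (metis of_nat_add of_nat_le_iff of_nat_mult)
      also have "\<dots> \<le> real n / real m * real (u m) + real C"
        by (intro add_right_mono mult_right_mono of_nat_div_le_of_nat) auto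
      finally have "real (u n) / real n \<le> (real n / real m * real (u m) + real C) / real n"
        by (intro divide_right_mono) auto
      also have "\<dots> = real (u m) / real m + real C / real n"
        using n0 by (simp add: field_simps)
      also have "real C / real n < e / 2"
      proof -
        have "2 * real C / e < real n" using N n by simp
        then show ?thesis using e n0 by (simp add: field_simps)
      qed
      finally have "real (u n) / real n < L + e" using m by simp
      moreover have "L \<le> real (u n) / real n" using n by (intro lower) simp
      ultimately show "norm (real (u n) / real n - L) < e" by simp
    qed
  qed
  then show ?thesis by (simp add: L_def)
qed

section \<open>Differences and norms of almost everywhere classes\<close>

lemma L2_subset_carrier: "L2 M \<subseteq> carrier (L0 M)"
  by (auto simp: L2_def ae_class_in_L0)

lemma L0_carrierE:
  assumes "u \<in> carrier (L0 M)"
  obtains f where "f \<in> borel_measurable M" "u = ae_class M f"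
  using assms
  by (auto simp: ae_class_def L0_def FactRing_def A_RCOSETS_defs a_r_coset_defs meas_ring_def)

lemma L0_minus:
  assumes "f \<in> borel_measurable M" "g \<in> borel_measurable M"
  shows "ae_class M f \<ominus>\<^bsub>L0 M\<^esub> ae_class M g = ae_class M (\<lambda>x. f x - g x)"
  using assms by (simp add: a_minus_def L0_uminus ae_class_add)

lemma L2_norm_nonneg: "L2_norm M u \<ge> 0"
  by (simp add: L2_norm_def)

lemma L2_norm_zero: "L2_norm M \<zero>\<^bsub>L0 M\<^esub> = 0"
  by (simp add: L0_zero L2_norm_ae_class)

text \<open>\<open>H_apr\<close> measures orbit point minus approximant, while the closeness
  hypothesis of the theorem has the approximant first; this mediates between the two.\<close>

lemma L2_norm_minus_commute:
  assumes "u \<in> carrier (L0 M)" "v \<in> carrier (L0 M)"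
  shows "L2_norm M (u \<ominus>\<^bsub>L0 M\<^esub> v) = L2_norm M (v \<ominus>\<^bsub>L0 M\<^esub> u)"
proof -
  obtain f g where "f \<in> borel_measurable M" "u = ae_class M f"
    "g \<in> borel_measurable M" "v = ae_class M g"
    using assms by (metis L0_carrierE)
  then show ?thesis by (simp add: L0_minus L2_norm_ae_class norm_minus_commute)
qed

lemma L2_minus:
  assumes "prob_space M" "u \<in> L2 M" "v \<in> L2 M"
  shows "u \<ominus>\<^bsub>L0 M\<^esub> v \<in> L2 M"
proof -
  interpret R: cring "L0 M :: ('a \<Rightarrow> 'b) set ring" by (rule L0_cring)
  have "subgroup (L2 M) (add_monoid (L0 M :: ('a \<Rightarrow> 'b) set ring))"
    using L2_lin_subspace[OF assms(1)] by (auto simp: lin_subspace_def subalgebra_def)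
  then show ?thesis
    using assms(2,3) subgroup.m_inv_closed subgroup.m_closed
    by (fastforce simp: a_minus_def a_inv_def)
qed

section \<open>The Koopman operator on classes and on subspaces\<close>

text \<open>Composition with \<open>\<phi>\<close> respects products as well as sums. Since scalars
  are themselves elements of \<open>L0 M\<close>, namely constants, the library results on images of
  subspaces under ring homomorphisms become available.\<close>

lemma koopman_ring_hom:
  assumes "measure_preserving M \<phi>"
  shows "ring_hom_ring (L0 M) (L0 M :: ('a \<Rightarrow> 'k::{real_normed_field, euclidean_space}) set ring)
    (koopman M \<phi>)"
proof -
  interpret R: cring "L0 M :: ('a \<Rightarrow> 'k) set ring" by (rule L0_cring)
  have \<phi>: "\<phi> \<in> measurable M M" using assms by (simp add: measure_preserving_def)
  have comp [measurable]: "f \<circ> \<phi> \<in> borel_measurable M" if "f \<in> borel_measurable M" for f :: "'a \<Rightarrow> 'k"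
    using measurable_comp[OF \<phi> that] .
  show ?thesis
  proof (rule ring_hom_ringI)
    fix u v :: "('a \<Rightarrow> 'k) set"
    assume "u \<in> carrier (L0 M)" "v \<in> carrier (L0 M)"
    then obtain f g where fg: "f \<in> borel_measurable M" "u = ae_class M f"
      "g \<in> borel_measurable M" "v = ae_class M g"
      by (metis L0_carrierE)
    have m: "(\<lambda>x. f x + g x) \<in> borel_measurable M" "(\<lambda>x. f x * g x) \<in> borel_measurable M"
      using fg by auto
    show "koopman M \<phi> (u \<oplus>\<^bsub>L0 M\<^esub> v) = koopman M \<phi> u \<oplus>\<^bsub>L0 M\<^esub> koopman M \<phi> v"
      using fg m by (simp add: ae_class_add koopman_ae_class[OF assms] comp) (simp add: comp_def)
    show "koopman M \<phi> (u \<otimes>\<^bsub>L0 M\<^esub> v) = koopman M \<phi> u \<otimes>\<^bsub>L0 M\<^esub> koopman M \<phi> v"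
      using fg m by (simp add: ae_class_mult koopman_ae_class[OF assms] comp) (simp add: comp_def)
  next
    fix u :: "('a \<Rightarrow> 'k) set"
    assume "u \<in> carrier (L0 M)"
    then obtain f where "f \<in> borel_measurable M" "u = ae_class M f" by (rule L0_carrierE)
    then show "koopman M \<phi> u \<in> carrier (L0 M)"
      by (simp add: koopman_ae_class[OF assms] ae_class_in_L0 comp)
  next
    show "koopman M \<phi> \<one>\<^bsub>L0 M\<^esub> = (\<one>\<^bsub>L0 M\<^esub> :: ('a \<Rightarrow> 'k) set)"
      by (simp add: L0_one koopman_ae_class[OF assms] comp_def)
  qed (rule R.ring_axioms)+
qed

text \<open>The set where the compositions with \<open>\<phi>\<close> differ is the preimage of the
  set where \<open>f\<close> and \<open>g\<close> differ. Both have the same measure, so one is null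
  exactly if the other is.\<close>

lemma koopman_inj:
  assumes "measure_preserving M \<phi>"
  shows "inj_on (koopman M \<phi>)
    (carrier (L0 M :: ('a \<Rightarrow> 'k::{real_normed_field, euclidean_space}) set ring))"
proof (rule inj_onI)
  fix u v :: "('a \<Rightarrow> 'k) set"
  assume "u \<in> carrier (L0 M)" "v \<in> carrier (L0 M)" and eq: "koopman M \<phi> u = koopman M \<phi> v"
  then obtain f g where fg [measurable]: "f \<in> borel_measurable M" "g \<in> borel_measurable M"
    and u: "u = ae_class M f" and v: "v = ae_class M g"
    by (metis L0_carrierE)
  have \<phi>: "\<phi> \<in> measurable M M" using assms by (simp add: measure_preserving_def)
  have m: "f \<circ> \<phi> \<in> borel_measurable M" "g \<circ> \<phi> \<in> borel_measurable M"
    by (rule measurable_comp[OF \<phi> fg(1)], rule measurable_comp[OF \<phi> fg(2)])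
  have "f \<circ> \<phi> \<in> ae_class M (g \<circ> \<phi>)"
  proof -
    have "ae_class M (f \<circ> \<phi>) = ae_class M (g \<circ> \<phi>)"
      using eq by (simp add: u v koopman_ae_class[OF assms])
    then show ?thesis using ae_class_eq[OF m(1)] m(1) by auto
  qed
  then have "AE x in M. f (\<phi> x) = g (\<phi> x)" using m by (simp add: ae_class_eq)
  moreover have "{x \<in> space M. f x = g x} \<in> sets M" by measurable
  ultimately have "AE x in distr M M \<phi>. f x = g x" by (simp add: AE_distr_iff[OF \<phi>])
  then have "AE x in M. f x = g x" unfolding measure_preserving_distr[OF assms] .
  then show "u = v" unfolding u v by (auto simp: ae_class_eq)
qed

text \<open>A ring homomorphism carries dimension over \<open>scalars M\<close> to dimension over
  the image of \<open>scalars M\<close>; this identifies the image field with the original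
  one.\<close>

lemma koopman_scalars:
  assumes "measure_preserving M \<phi>"
  shows "koopman M \<phi> ` scalars M = scalars M"
  by (simp add: scalars_def image_image koopman_ae_class[OF assms] comp_def)

lemma koopman_pow_L2:
  assumes "measure_preserving M \<phi>" "u \<in> L2 M"
  shows "(koopman M \<phi> ^^ k) u \<in> L2 M"
  by (induction k) (auto intro: koopman_L2 assms)

text \<open>Differences pass through the homomorphism, and invariance of the norm then applies to
  the difference, which lies in \<open>L2 M\<close>.\<close>

lemma koopman_pow_dist:
  assumes "prob_space M" "measure_preserving M \<phi>" "u \<in> L2 M" "v \<in> L2 M"
  shows "L2_norm M ((koopman M \<phi> ^^ k) u \<ominus>\<^bsub>L0 M\<^esub> (koopman M \<phi> ^^ k) v) = L2_norm M (u \<ominus>\<^bsub>L0 M\<^esub> v)"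
proof (induction k)
  case (Suc k)
  interpret T: ring_hom_ring "L0 M" "L0 M :: ('a \<Rightarrow> 'b) set ring" "koopman M \<phi>"
    by (rule koopman_ring_hom[OF assms(2)])
  define x y where "x = (koopman M \<phi> ^^ k) u" and "y = (koopman M \<phi> ^^ k) v"
  have xy: "x \<in> L2 M" "y \<in> L2 M" using assms koopman_pow_L2 by (auto simp: x_def y_def)
  then have xy': "x \<in> carrier (L0 M)" "y \<in> carrier (L0 M)" using L2_subset_carrier by auto
  have "koopman M \<phi> x \<ominus>\<^bsub>L0 M\<^esub> koopman M \<phi> y = koopman M \<phi> (x \<ominus>\<^bsub>L0 M\<^esub> y)"
    using xy' by (simp add: a_minus_def)
  then show ?case
    using Suc koopman_L2(2)[OF assms(2) L2_minus[OF assms(1) xy]] by (simp add: x_def y_def)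
qed simp

text \<open>An injective homomorphism that maps the scalar field onto itself preserves dimension.
  That the image stays in \<open>L2 M\<close> is a separate fact about integrals.\<close>

lemma koopman_fin_dim:
  assumes "prob_space M" "measure_preserving M \<phi>" "fin_dim_subspace M E"
  shows "fin_dim_subspace M (koopman M \<phi> ` E) \<and> lin_dim M (koopman M \<phi> ` E) = lin_dim M E"
proof -
  interpret T: ring_hom_ring "L0 M" "L0 M :: ('a \<Rightarrow> 'b) set ring" "koopman M \<phi>"
    by (rule koopman_ring_hom[OF assms(2)])
  note sf = scalars_subfield[OF assms(1)]
  have E: "E \<subseteq> L2 M" "T.R.finite_dimension (scalars M) E"
    using assms(3) by (auto simp: fin_dim_subspace_def lin_subspace_def)
  then have "inj_on (koopman M \<phi>) E"
    using koopman_inj[OF assms(2)] L2_subset_carrier by (metis inj_on_subset)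
  moreover have "T.R.dimension (lin_dim M E) (scalars M) E"
    using T.R.finite_dimensionE[OF sf E(2)] by (simp add: lin_dim_def over_def)
  ultimately have dim: "T.R.dimension (lin_dim M E) (scalars M) (koopman M \<phi> ` E)"
    using T.inj_hom_dimension[OF sf] subfieldE(6)[OF sf] koopman_scalars[OF assms(2)]
    by metis
  then have fd: "T.R.finite_dimension (scalars M) (koopman M \<phi> ` E)"
    by (rule T.R.finite_dimensionI)
  have "koopman M \<phi> ` E \<subseteq> L2 M" using E koopman_L2(1)[OF assms(2)] by auto
  then have "fin_dim_subspace M (koopman M \<phi> ` E)"
    using fd T.R.finite_dimension_imp_subalgebra[OF sf fd]
    by (simp add: fin_dim_subspace_def lin_subspace_def)
  moreover have "lin_dim M (koopman M \<phi> ` E) = lin_dim M E"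
    using T.R.dimI[OF sf dim] by (simp add: lin_dim_def over_def)
  ultimately show ?thesis ..
qed

lemma koopman_pow_fin_dim:
  assumes "prob_space M" "measure_preserving M \<phi>" "fin_dim_subspace M E"
  shows "fin_dim_subspace M ((koopman M \<phi> ^^ k) ` E) \<and>
    lin_dim M ((koopman M \<phi> ^^ k) ` E) = lin_dim M E"
proof (induction k)
  case (Suc k)
  then show ?case
    using koopman_fin_dim[OF assms(1,2), of "(koopman M \<phi> ^^ k) ` E"] by (simp add: image_comp)
qed (use assms(3) in simp)

section \<open>Sums and spans of finite-dimensional subspaces\<close>

text \<open>The witness is the sum of the two subspaces, bounded by the dimension formula for sums.
  Each summand is contained in it because the other one contains zero.\<close>

lemma fin_dim_sum:
  assumes "prob_space M" "fin_dim_subspace M V" "fin_dim_subspace M W"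
  shows "\<exists>U. fin_dim_subspace M U \<and> V \<subseteq> U \<and> W \<subseteq> U \<and> lin_dim M U \<le> lin_dim M V + lin_dim M W"
proof -
  interpret R: cring "L0 M :: ('a \<Rightarrow> 'b) set ring" by (rule L0_cring)
  note sf = scalars_subfield[OF assms(1)]
  define U where "U = V <+>\<^bsub>L0 M\<^esub> W"
  have V: "V \<subseteq> L2 M" "R.finite_dimension (scalars M) V" "subgroup V (add_monoid (L0 M))"
    and W: "W \<subseteq> L2 M" "R.finite_dimension (scalars M) W" "subgroup W (add_monoid (L0 M))"
    using assms(2,3) by (auto simp: fin_dim_subspace_def lin_subspace_def subalgebra_def)
  have "subgroup (L2 M) (add_monoid (L0 M :: ('a \<Rightarrow> 'b) set ring))"
    using L2_lin_subspace[OF assms(1)] by (auto simp: lin_subspace_def subalgebra_def)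
  from subgroup.m_closed[OF this] have UL2: "U \<subseteq> L2 M"
    using V(1) W(1) by (fastforce simp: U_def set_add_def set_mult_def)
  have fd: "R.finite_dimension (scalars M) U"
    unfolding U_def by (rule R.sum_space_dim(1)[OF sf V(2) W(2)])
  have "lin_dim M U \<le> lin_dim M V + lin_dim M W"
    using R.sum_space_dim(2)[OF sf V(2) W(2)] by (simp add: lin_dim_def over_def U_def)
  moreover have "fin_dim_subspace M U"
    using UL2 fd R.finite_dimension_imp_subalgebra[OF sf fd]
    by (simp add: fin_dim_subspace_def lin_subspace_def)
  moreover have "V \<subseteq> U"
  proof
    fix x assume "x \<in> V"
    moreover from this have "x \<in> carrier (L0 M)" using V(1) L2_subset_carrier by blast
    ultimately show "x \<in> U"
      using subgroup.one_closed[OF W(3)] by (force simp: U_def set_add_def set_mult_def)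
  qed
  moreover have "W \<subseteq> U"
  proof
    fix x assume "x \<in> W"
    moreover from this have "x \<in> carrier (L0 M)" using W(1) L2_subset_carrier by blast
    ultimately show "x \<in> U"
      using subgroup.one_closed[OF V(3)] by (force simp: U_def set_add_def set_mult_def)
  qed
  ultimately show ?thesis by blast
qed

text \<open>\<open>lin_span\<close> is an intersection of subspaces. Since \<open>E\<close> is one
  of them, the family is nonempty and the intersection lies inside \<open>E\<close>.\<close>

lemma lin_span_fin_dim:
  assumes "prob_space M" "fin_dim_subspace M E" "S \<subseteq> E"
  shows "fin_dim_subspace M (lin_span M S)"
proof -
  interpret R: cring "L0 M :: ('a \<Rightarrow> 'b) set ring" by (rule L0_cring)
  note sf = scalars_subfield[OF assms(1)]
  define \<V> where "\<V> = {V. lin_subspace M V \<and> S \<subseteq> V}"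
  have E: "E \<in> \<V>" "E \<subseteq> L2 M" "R.finite_dimension (scalars M) E"
    using assms by (auto simp: \<V>_def fin_dim_subspace_def lin_subspace_def)
  have sub: "subalgebra (scalars M) V (L0 M)" if "V \<in> \<V>" for V
    using that by (simp add: \<V>_def lin_subspace_def)
  have "subgroup (\<Inter>\<V>) (add_monoid (L0 M))"
    using E sub by (intro R.add.subgroups_Inter) (auto simp: subalgebra_def)
  then have "subalgebra (scalars M) (\<Inter>\<V>) (L0 M)"
    using sub by (auto simp: subalgebra_def subalgebra_axioms_def)
  moreover from this have "R.finite_dimension (scalars M) (\<Inter>\<V>)"
    using R.subalbegra_incl_imp_finite_dimension[OF sf E(3)] E(1) by blast
  ultimately show ?thesis
    using E unfolding fin_dim_subspace_def lin_span_def \<V>_def[symmetric] lin_subspace_def[of M "\<Inter>\<V>"]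
    by blast
qed

section \<open>Approximation numbers along orbits\<close>

text \<open>The condition on the competing subspaces in \<open>H_apr\<close>, isolated so that
  minimality and attainment of the \<open>LEAST\<close> can be used separately.\<close>

definition approximates where
  "approximates M E \<omega> \<delta> \<longleftrightarrow>
     fin_dim_subspace M E \<and> (\<forall>x\<in>\<omega>. \<exists>y\<in>E. L2_norm M (x \<ominus>\<^bsub>L0 M\<^esub> y) < \<delta>)"

lemma H_apr_le:
  assumes "approximates M E \<omega> \<delta>"
  shows "H_apr M \<omega> \<delta> \<le> lin_dim M E"
  unfolding H_apr_def by (rule Least_le) (use assms in \<open>auto simp: approximates_def\<close>)

text \<open>\<open>LEAST\<close> over an empty set of dimensions would carry no information, so some
  approximating subspace has to be exhibited first.\<close>

lemma H_apr_attained: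
  assumes "approximates M E \<omega> \<delta>"
  obtains E' where "approximates M E' \<omega> \<delta>" "lin_dim M E' = H_apr M \<omega> \<delta>"
proof -
  have "\<exists>E. fin_dim_subspace M E \<and> lin_dim M E = H_apr M \<omega> \<delta> \<and>
     (\<forall>x\<in>\<omega>. \<exists>y\<in>E. L2_norm M (x \<ominus>\<^bsub>L0 M\<^esub> y) < \<delta>)"
    unfolding H_apr_def by (rule LeastI_ex) (use assms in \<open>auto simp: approximates_def\<close>)
  then show ?thesis using that by (auto simp: approximates_def)
qed

lemma approximates_superset:
  assumes "fin_dim_subspace M E" "\<omega> \<subseteq> E" "\<delta> > 0"
  shows "approximates M E \<omega> \<delta>"
proof -
  interpret R: cring "L0 M :: ('a \<Rightarrow> 'b) set ring" by (rule L0_cring)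
  have "L2_norm M (x \<ominus>\<^bsub>L0 M\<^esub> x) = 0" if "x \<in> \<omega>" for x
  proof -
    have "x \<in> carrier (L0 M)"
      using that assms L2_subset_carrier by (fastforce simp: fin_dim_subspace_def lin_subspace_def)
    then show ?thesis by (simp add: a_minus_def R.r_neg L2_norm_zero)
  qed
  then show ?thesis using assms by (force simp: approximates_def)
qed

lemma finite_orbit_approximates_sum:
  assumes "prob_space M" "measure_preserving M \<phi>" "\<omega> \<subseteq> L2 M"
    and V: "approximates M V (\<Union>k<m. (koopman M \<phi> ^^ k) ` \<omega>) \<delta>"
    and W: "approximates M W (\<Union>k<n. (koopman M \<phi> ^^ k) ` \<omega>) \<delta>"
  shows "\<exists>U. approximates M U (\<Union>k<m+n. (koopman M \<phi> ^^ k) ` \<omega>) \<delta> \<and>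
    lin_dim M U \<le> lin_dim M V + lin_dim M W"
proof -
  define T where "T = (koopman M \<phi> :: ('a \<Rightarrow> 'b) set \<Rightarrow> _)"
  have TW: "fin_dim_subspace M ((T ^^ m) ` W)" "lin_dim M ((T ^^ m) ` W) = lin_dim M W"
    using koopman_pow_fin_dim[OF assms(1,2)] W by (auto simp: approximates_def T_def)
  obtain U where U: "fin_dim_subspace M U" "V \<subseteq> U" "(T ^^ m) ` W \<subseteq> U"
      "lin_dim M U \<le> lin_dim M V + lin_dim M W"
    using fin_dim_sum[OF assms(1) _ TW(1), of V] V TW(2) by (auto simp: approximates_def)
  have "\<exists>y\<in>U. L2_norm M ((T ^^ k) f \<ominus>\<^bsub>L0 M\<^esub> y) < \<delta>" if k: "k < m + n" and f: "f \<in> \<omega>" for k f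
  proof (cases "k < m")
    case True
    then show ?thesis using V U(2) f by (fastforce simp: approximates_def T_def)
  next
    case False
    \<comment> \<open>A point of the second block is \<open>T ^^ m\<close> of a point approximated
      by some \<open>y\<close> in \<open>W\<close>. As \<open>T\<close> is an isometry,
      \<open>(T ^^ m) y\<close> is an equally good approximant.\<close>
    then have kn: "k - m < n" using k by linarith
    obtain y where y: "y \<in> W" "L2_norm M ((T ^^ (k - m)) f \<ominus>\<^bsub>L0 M\<^esub> y) < \<delta>"
      using W kn f by (fastforce simp: approximates_def T_def)
    have "y \<in> L2 M" using y W by (auto simp: approximates_def fin_dim_subspace_def lin_subspace_def)
    moreover have "(T ^^ (k - m)) f \<in> L2 M"
      using koopman_pow_L2[OF assms(2)] f assms(3) by (auto simp: T_def)
    moreover have "(T ^^ k) f = (T ^^ m) ((T ^^ (k - m)) f)"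
      using False by (metis comp_apply funpow_add le_add_diff_inverse not_less)
    ultimately have "L2_norm M ((T ^^ k) f \<ominus>\<^bsub>L0 M\<^esub> (T ^^ m) y) < \<delta>"
      using y by (simp add: T_def koopman_pow_dist[OF assms(1,2)])
    then show ?thesis using U(3) y by blast
  qed
  then show ?thesis using U by (auto simp: approximates_def T_def)
qed

text \<open>Provides the existence that \<open>H_apr_attained\<close> asks for. \<open>F\<close>
  approximates the block of length 1, and each induction step appends one such block.\<close>

lemma finite_orbit_approximates:
  assumes "prob_space M" "measure_preserving M \<phi>" "fin_dim_subspace M F" "\<omega> \<subseteq> F" "\<delta> > 0"
  shows "\<exists>E. approximates M E (\<Union>k<n. (koopman M \<phi> ^^ k) ` \<omega>) \<delta>"
proof (induction n)
  case 0
  then show ?case using assms(3) by (auto simp: approximates_def)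
next
  case (Suc n)
  have "approximates M F (\<Union>k<1. (koopman M \<phi> ^^ k) ` \<omega>) \<delta>"
    using approximates_superset[OF assms(3-5)] by (simp add: lessThan_Suc)
  moreover have "\<omega> \<subseteq> L2 M" using assms by (auto simp: fin_dim_subspace_def lin_subspace_def)
  ultimately show ?case
    using Suc finite_orbit_approximates_sum[OF assms(1,2), of \<omega> _ n \<delta> F 1]
    by (metis Suc_eq_plus1)
qed

lemma H_apr_subadditive:
  assumes "prob_space M" "measure_preserving M \<phi>" "fin_dim_subspace M F" "\<omega> \<subseteq> F" "\<delta> > 0"
  shows "H_apr M (\<Union>k<m+n. (koopman M \<phi> ^^ k) ` \<omega>) \<delta>
    \<le> H_apr M (\<Union>k<m. (koopman M \<phi> ^^ k) ` \<omega>) \<delta> + H_apr M (\<Union>k<n. (koopman M \<phi> ^^ k) ` \<omega>) \<delta>"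
proof -
  have \<omega>: "\<omega> \<subseteq> L2 M" using assms by (auto simp: fin_dim_subspace_def lin_subspace_def)
  obtain V where V: "approximates M V (\<Union>k<m. (koopman M \<phi> ^^ k) ` \<omega>) \<delta>"
    "lin_dim M V = H_apr M (\<Union>k<m. (koopman M \<phi> ^^ k) ` \<omega>) \<delta>"
    using finite_orbit_approximates[OF assms] H_apr_attained by metis
  obtain W where W: "approximates M W (\<Union>k<n. (koopman M \<phi> ^^ k) ` \<omega>) \<delta>"
    "lin_dim M W = H_apr M (\<Union>k<n. (koopman M \<phi> ^^ k) ` \<omega>) \<delta>"
    using finite_orbit_approximates[OF assms] H_apr_attained by metis
  obtain U where U: "approximates M U (\<Union>k<m+n. (koopman M \<phi> ^^ k) ` \<omega>) \<delta>"
    "lin_dim M U \<le> lin_dim M V + lin_dim M W"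
    using finite_orbit_approximates_sum[OF assms(1,2) \<omega> V(1) W(1)] by blast
  show ?thesis
    using H_apr_le[OF U(1)] U(2) unfolding V(2) W(2) by (rule order_trans)
qed

text \<open>By subadditivity and \<open>fekete\<close> the \<open>lim\<close> in
  \<open>h_apr_at\<close> exists and is the infimum of the quotients over
  \<open>n \<ge> 1\<close>.\<close>

lemma h_apr_at_le:
  assumes "prob_space M" "measure_preserving M \<phi>" "fin_dim_subspace M F" "\<omega> \<subseteq> F" "\<delta> > 0" "n \<ge> 1"
  shows "h_apr_at M (koopman M \<phi>) \<omega> \<delta>
    \<le> real (H_apr M (\<Union>k<n. (koopman M \<phi> ^^ k) ` \<omega>) \<delta>) / real n"
proof -
  define u where "u n = H_apr M (\<Union>k<n. (koopman M \<phi> ^^ k) ` \<omega>) \<delta>" for n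
  have "u (m + n) \<le> u m + u n" for m n
    unfolding u_def by (rule H_apr_subadditive[OF assms(1-5)])
  then have "h_apr_at M (koopman M \<phi>) \<omega> \<delta> = (INF n\<in>{1..}. real (u n) / real n)"
    using fekete[of u] by (auto simp: h_apr_at_def u_def intro: limI)
  also have "\<dots> \<le> real (u n) / real n"
    by (rule cINF_lower) (use assms(6) in \<open>auto intro!: bdd_belowI[of _ 0]\<close>)
  finally show ?thesis by (simp add: u_def)
qed

text \<open>In the quotient for \<open>n = 1\<close>, \<open>F\<close> itself is an approximating
  subspace. The bound keeps \<open>h_apr\<close> below infinity.\<close>

lemma h_apr_le_dim:
  assumes "prob_space M" "measure_preserving M \<phi>" "fin_dim_subspace M F"
  shows "h_apr M (koopman M \<phi>) F \<le> ereal (real (lin_dim M F))"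
  unfolding h_apr_def h_apr_fin_def
proof (intro SUP_least)
  fix \<omega> \<delta> assume *: "\<omega> \<in> {\<omega>. finite \<omega> \<and> \<omega> \<subseteq> F}" "\<delta> \<in> {0::real<..}"
  have "h_apr_at M (koopman M \<phi>) \<omega> \<delta> \<le> real (H_apr M \<omega> \<delta>)"
    using h_apr_at_le[OF assms, of \<omega> \<delta> 1] * by (simp add: lessThan_Suc)
  also have "\<dots> \<le> real (lin_dim M F)"
    using H_apr_le[OF approximates_superset[OF assms(3)]] * by simp
  finally show "ereal (h_apr_at M (koopman M \<phi>) \<omega> \<delta>) \<le> ereal (real (lin_dim M F))" by simp
qed

section \<open>The spaces \<open>Fn n\<close> and the lower bound for their dimension\<close>

text \<open>Finitely many images of \<open>F\<close> fit into one finite-dimensional subspace, built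
  by adding one image at a time; the span lies inside it.\<close>

lemma finite_orbit_span_fin_dim:
  assumes "prob_space M" "measure_preserving M \<phi>" "fin_dim_subspace M F"
  shows "fin_dim_subspace M (lin_span M (\<Union>k\<le>n. (koopman M \<phi> ^^ k) ` F))"
proof -
  have "\<exists>E. fin_dim_subspace M E \<and> (\<Union>k\<le>n. (koopman M \<phi> ^^ k) ` F) \<subseteq> E"
  proof (induction n)
    case 0
    then show ?case using assms(3) by auto
  next
    case (Suc n)
    then obtain E where E: "fin_dim_subspace M E" "(\<Union>k\<le>n. (koopman M \<phi> ^^ k) ` F) \<subseteq> E" by blast
    obtain U where "fin_dim_subspace M U" "E \<subseteq> U" "(koopman M \<phi> ^^ Suc n) ` F \<subseteq> U"
      using fin_dim_sum[OF assms(1) E(1)] koopman_pow_fin_dim[OF assms] by blast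
    then show ?case using E(2) unfolding atMost_Suc by (intro exI[of _ U]) blast
  qed
  then show ?thesis using lin_span_fin_dim[OF assms(1)] by blast
qed

theorem theorem1p3:
  fixes M :: "'a measure" and \<phi> :: "'a \<Rightarrow> 'a"
    and F :: "('a \<Rightarrow> 'k::{real_normed_field, euclidean_space}) set set"
    and Fn :: "nat \<Rightarrow> ('a \<Rightarrow> 'k) set set"
    and \<epsilon> :: real
  assumes "\<And>n. Fn n = lin_span M (\<Union>k\<le>n. (koopman M \<phi> ^^ k) ` F)"
    and "invertible_mps M \<phi>"
    and "fin_dim_subspace M F"
    and "\<epsilon> > 0"
  shows "\<exists>(K0::nat) \<delta>::real. \<delta> > 0 \<and>
    (\<forall>(n::nat) (K::nat) S. K \<ge> K0 \<longrightarrow> linear_operator_on M (Fn n) S \<longrightarrow>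
       (\<forall>f\<in>Fn n. \<forall>k<K.
          L2_norm M ((S ^^ k) f \<ominus>\<^bsub>L0 M\<^esub> (koopman M \<phi> ^^ k) f) \<le> \<delta> * L2_norm M f) \<longrightarrow>
       ereal (real (lin_dim M (Fn n))) \<ge> ereal (real K) * (h_apr M (koopman M \<phi>) F - ereal \<epsilon>))"
proof -
  define T where "T = (koopman M \<phi> :: ('a \<Rightarrow> 'k) set \<Rightarrow> _)"
  have P: "prob_space M" "measure_preserving M \<phi>"
    using assms(2) by (auto simp: invertible_mps_def)
  \<comment> \<open>The empty set with tolerance 1 excludes minus infinity, the dimension of
    \<open>F\<close> excludes infinity. So the entropy is a real \<open>h\<close>, and the
    \<open>ereal\<close> arithmetic of the claim reduces to real arithmetic.\<close>
  have "ereal (h_apr_at M T {} 1) \<le> h_apr M T F"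
    unfolding h_apr_def h_apr_fin_def by (rule SUP_upper2[of "{}"], simp, rule SUP_upper) simp
  moreover have "h_apr M T F \<le> ereal (real (lin_dim M F))"
    unfolding T_def by (rule h_apr_le_dim[OF P assms(3)])
  ultimately obtain h where h: "h_apr M T F = ereal h" by (cases "h_apr M T F") auto
  have "ereal (h - \<epsilon>) < h_apr M T F" using assms(4) h by simp
  then obtain \<omega> \<eta> where \<omega>: "finite \<omega>" "\<omega> \<subseteq> F" and \<eta>: "\<eta> > 0"
    and large: "h - \<epsilon> < h_apr_at M T \<omega> \<eta>"
    unfolding h_apr_def h_apr_fin_def by (auto simp: less_SUP_iff)
  \<comment> \<open>A sum rather than a maximum, so that empty \<open>\<omega>\<close> is
    covered.\<close>
  define N where "N = (\<Sum>f\<in>\<omega>. L2_norm M f)"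
  have N: "L2_norm M f \<le> N" if "f \<in> \<omega>" for f
    unfolding N_def using that \<omega>(1) L2_norm_nonneg by (intro member_le_sum) auto
  have "N \<ge> 0" unfolding N_def by (intro sum_nonneg L2_norm_nonneg)
  \<comment> \<open>The summand 1 keeps the denominator positive and makes
    \<open>\<delta> * N < \<eta>\<close> strict, as \<open>H_apr\<close> demands.\<close>
  define \<delta> where "\<delta> = \<eta> / (N + 1)"
  have \<delta>: "\<delta> > 0" "\<delta> * N < \<eta>"
    using \<eta> \<open>N \<ge> 0\<close> by (auto simp: \<delta>_def field_simps)
  show ?thesis
  \<comment> \<open>\<open>K0 = 0\<close> suffices, since the limit bounds every single quotient
    from below. \<open>\<delta>\<close> was chosen from \<open>\<omega>\<close> and
    \<open>\<eta>\<close> alone, before \<open>n\<close>, \<open>K\<close> and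
    \<open>S\<close>.\<close>
  proof (rule exI[of _ "0::nat"], rule exI[of _ \<delta>], intro conjI allI impI)
    fix n K :: nat and S :: "('a \<Rightarrow> 'k) set \<Rightarrow> ('a \<Rightarrow> 'k) set"
    assume S: "linear_operator_on M (Fn n) S"
      and close: "\<forall>f\<in>Fn n. \<forall>k<K.
        L2_norm M ((S ^^ k) f \<ominus>\<^bsub>L0 M\<^esub> (koopman M \<phi> ^^ k) f) \<le> \<delta> * L2_norm M f"
    have fd: "fin_dim_subspace M (Fn n)"
      unfolding assms(1) by (rule finite_orbit_span_fin_dim[OF P assms(3)])
    then have FnL2: "Fn n \<subseteq> L2 M" by (auto simp: fin_dim_subspace_def lin_subspace_def)
    have "F \<subseteq> (\<Union>k\<le>n. (koopman M \<phi> ^^ k) ` F)" by (auto intro!: bexI[of _ 0])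
    then have FFn: "F \<subseteq> Fn n" unfolding assms(1) lin_span_def by blast
    \<comment> \<open>Invariance of \<open>Fn n\<close> under \<open>S\<close> puts all approximants
      \<open>(S ^^ k) f\<close> into this one space.\<close>
    have Sk: "(S ^^ k) f \<in> Fn n" if "f \<in> Fn n" for k f
      by (induction k) (use that S in \<open>auto simp: linear_operator_on_def\<close>)
    have "approximates M (Fn n) (\<Union>k<K. (T ^^ k) ` \<omega>) \<eta>"
      unfolding approximates_def
    proof (intro conjI fd ballI)
      fix x assume "x \<in> (\<Union>k<K. (T ^^ k) ` \<omega>)"
      then obtain k f where k: "k < K" and f: "f \<in> \<omega>" and x: "x = (T ^^ k) f" by auto
      have fF: "f \<in> Fn n" using f \<omega>(2) FFn by blast
      have "x \<in> L2 M" using koopman_pow_L2[OF P(2)] fF FnL2 by (auto simp: x T_def)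
      then have "L2_norm M (x \<ominus>\<^bsub>L0 M\<^esub> (S ^^ k) f) = L2_norm M ((S ^^ k) f \<ominus>\<^bsub>L0 M\<^esub> x)"
        using Sk[OF fF] FnL2 L2_subset_carrier by (intro L2_norm_minus_commute) blast+
      also have "\<dots> \<le> \<delta> * L2_norm M f" using close fF k by (simp add: x T_def)
      also have "\<dots> \<le> \<delta> * N" using \<delta>(1) N[OF f] by simp
      finally show "\<exists>y\<in>Fn n. L2_norm M (x \<ominus>\<^bsub>L0 M\<^esub> y) < \<eta>"
        using \<delta>(2) Sk[OF fF] by (intro bexI[of _ "(S ^^ k) f"]) auto
    qed
    then have H: "H_apr M (\<Union>k<K. (T ^^ k) ` \<omega>) \<eta> \<le> lin_dim M (Fn n)" by (rule H_apr_le)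
    have "real K * (h - \<epsilon>) \<le> real (lin_dim M (Fn n))"
    \<comment> \<open>For \<open>K = 0\<close> the left side is 0, and there is no quotient to
      compare with.\<close>
    proof (cases "K = 0")
      case False
      then have "h - \<epsilon> \<le> real (H_apr M (\<Union>k<K. (T ^^ k) ` \<omega>) \<eta>) / real K"
        using large h_apr_at_le[OF P assms(3) \<omega>(2) \<eta>, of K] by (simp add: T_def)
      then have "real K * (h - \<epsilon>) \<le> real (H_apr M (\<Union>k<K. (T ^^ k) ` \<omega>) \<eta>)"
        using False by (simp add: field_simps)
      then show ?thesis using H by linarith
    qed simp
    then show "ereal (real (lin_dim M (Fn n)))
        \<ge> ereal (real K) * (h_apr M (koopman M \<phi>) F - ereal \<epsilon>)"
      using h by (simp add: T_def)
  qed (rule \<delta>(1))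
qed

end
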